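(* Let $\Gamma = (N, H, P, \{\mathcal{I}_i\}_{i\in N}, \{u_i\}_{i\in N})$ be a finite extensive game (without chance moves) with two available actions at each information set, i.e. $|A(I_i)| = 2$ for every $i \in N$ and every information set $I_i \in \mathcal{I}_i$. Then there exists a six-tuple $\Gamma^{\mathrm{QI}} = (\mathscr{H}, N, |\psi_{\mathrm{in}}\rangle, \xi, \{\mathcal{U}_j\}, \{E_i\})$ (a quantum game in the sense defined in the context, with the same player set $N$) such that the strategic game specified by $\Gamma^{\mathrm{QI}}$ is isomorphic to the normal representation of $\Gamma$.
   Context: **Finite extensive game (without chance moves).** A five-tuple $(N, H, P, \{\mathcal{I}_i\}, \{u_i\})$ where: - $N = \{1,2,\dots,n\}$ is a finite set of players. - $H$ is a finite set of finite sequences (histories) such that the empty sequence $\emptyset$ belongs to $H$, and if $(a_k)_{k=1,\dots,K}\in H$ and $L<K$ then $(a_k)_{k=1,\dots,L}\in H$. Components of histories are called actions. A history $(a_1,\dots,a_K)\in H$ is terminal if there is no $a_{K+1}$ with $(a_1,\dots,a_K,a_{K+1})\in H$; $Z$ denotes the set of terminal histories. For a nonterminal history $h$, $A(h) = \{a : (h,a)\in H\}$. - $P\colon H\setminus Z\to N$ is the player function. - For each $i\in N$, $\mathcal{I}_i$ is a partition of $\{h\in H\setminus Z : P(h)=i\}$ such that $A(h)=A(h')$ whenever $h,h'$ lie in the same cell $I_i\in\mathcal{I}_i$. The cells are called information sets of player $i$; $A(I_i)$ denotes the common value of $A(h)$ for $h\in I_i$. - For each $i\in N$, $u_i\colon Z\to\mathbb{R}$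 is a utility function. **Strategies and outcome.** A pure strategy $s_i$ of player $i$ is a function assigning to each information set $I_i\in\mathcal{I}_i$ an action in $A(I_i)$. For a profile $s=(s_1,\dots,s_n)$ of pure strategies, the outcome $O(s)$ is the terminal history $(a_1,\dots,a_K)\in Z$ such that for every $0\le k<K$, $a_{k+1}$ is the action that $s_{P(a_1,\dots,a_k)}$ assigns to the information set containing $(a_1,\dots,a_k)$. **Strategic game and normal representation.** A strategic game is a triple $(N,\{S_i\}_{i\in N},\{u_i\}_{i\in N})$ of a player set, strategy sets $S_i$, and utility functions $u_i\colon\prod_{k\in N}S_k\to\mathbb{R}$. The normal representation of an extensive game $(N, H, P, \{\mathcal{I}_i\}, \{u_i\})$ is the strategic game $(N,\{S_i\},\{u_i'\})$ where $S_i$ is the set of pure strategies of player $i$ in the extensive game and $u_i'(s) = u_i(O(s))$ for every $s\in\prod_{k\in N}S_k$. **Isomorphism.** Strategic games $(N,\{S_i\},\{u_i\})$ and $(N,\{S_i'\},\{u_i'\})$ with the same player set are isomorphic if there are bijections $g_i\colon S_i\to S_i'$, $i\in N$, such that, with $g=\prod_{i\in N}g_i$, $u_i(s)=u_i'(g(s))$ for every $i\in N$ and every profile $s\in\prod_{k\in N}S_k$. **Quantum game (six-tuple).** $\Gamma^{\mathrm{QI}} = (\mathscr{H}, N, |\psi_{\mathrm{in}}\rangle, \xi, \{\mathcal{U}_j\}, \{E_i\})$ where: - $\mathscr{H}=\bigotimes_{j=1}^m\mathbb{C}^2$ is a complex Hilbert space ($m$ a positive integer) with a chosen orthonormal basis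 $\mathcal{B}$. - $N$ is a set of players with $|N|\le m$. - $|\psi_{\mathrm{in}}\rangle\in\mathscr{H}$ is a unit vector (the initial state of a system of $m$ qubits). - $\xi\colon\{1,\dots,m\}\to N$ is a surjective map ($\xi(j)$ is the player who acts on qubit $j$). - For each $j\in\{1,\dots,m\}$, $\mathcal{U}_j\subseteq\mathsf{SU}(2)$ is the set of unitary operators available for qubit $j$. A pure strategy of player $i$ is a map $\tau_i$ assigning to each $j\in\xi^{-1}(i)$ an operator $U_j\in\mathcal{U}_j$. For a strategy profile $\tau=(\tau_i)_{i\in N}$, the final state is $|\psi_{\mathrm{fin}}\rangle=\left(\bigotimes_{j=1}^mU_j\right)|\psi_{\mathrm{in}}\rangle$, where $U_j=\tau_{\xi(j)}(j)$ acts on the $j$-th tensor factor. - For each $i\in N$, $E_i$ is a payoff functional of the form $E_i=\sum_{|b\rangle\in\mathcal{B}}v_i(b)\,|\langle b|\psi_{\mathrm{fin}}\rangle|^2$ with real numbers $v_i(b)$. **Strategic game specified by the six-tuple.** It is $(N,\{\mathcal{T}_i\},\{E_i\})$, where $\mathcal{T}_i$ is the set of pure strategies $\tau_i$ of player $i$ and $E_i(\tau)$ is the value of $E_i$ at the final state resulting from the profile $\tau$. *)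

theory Defs
  imports "HOL-Analysis.Analysis" "HOL-Library.FuncSet" "HOL-Library.Disjoint_Sets"
begin

section \<open>Finite extensive games without chance moves\<close>

record 'a extensive_game =
  eg_players :: "nat set"
  eg_histories :: "'a list set"
  eg_player_fun :: "'a list \<Rightarrow> nat"
  eg_info :: "nat \<Rightarrow> 'a list set set"
  eg_utility :: "nat \<Rightarrow> 'a list \<Rightarrow> real"

definition terminal_histories :: "'a extensive_game \<Rightarrow> 'a list set" where
  "terminal_histories G = {h \<in> eg_histories G. \<nexists>a. h @ [a] \<in> eg_histories G}"

definition decision_histories :: "'a extensive_game \<Rightarrow> 'a list set" where
  "decision_histories G = eg_histories G - terminal_histories G"

definition actions :: "'a extensive_game \<Rightarrow> 'a list \<Rightarrow> 'a set" where
  "actions G h = {a. h @ [a] \<in> eg_histories G}"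

text \<open>The player function is only meaningful on decision histories, the utilities only on
  terminal histories, and \<open>eg_info G i\<close> and \<open>eg_utility G i\<close> only for players \<open>i\<close>; values
  elsewhere are irrelevant.\<close>

definition is_extensive_game :: "'a extensive_game \<Rightarrow> bool" where
  "is_extensive_game G \<longleftrightarrow>
     (\<exists>n\<ge>1. eg_players G = {1..n}) \<and>
     finite (eg_histories G) \<and>
     [] \<in> eg_histories G \<and>
     (\<forall>h\<in>eg_histories G. \<forall>L<length h. take L h \<in> eg_histories G) \<and>
     (\<forall>h\<in>decision_histories G. eg_player_fun G h \<in> eg_players G) \<and>
     (\<forall>i\<in>eg_players G.
        partition_on {h \<in> decision_histories G. eg_player_fun G h = i} (eg_info G i) \<and>
        (\<forall>I\<in>eg_info G i. \<forall>h\<in>I. \<forall>h'\<in>I. actions G h = actions G h'))"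

text \<open>The common value of \<open>actions G h\<close> over all \<open>h\<close> in the information set \<open>I\<close>.\<close>

definition info_actions :: "'a extensive_game \<Rightarrow> 'a list set \<Rightarrow> 'a set" where
  "info_actions G I = the_elem (actions G ` I)"

definition pure_strategies :: "'a extensive_game \<Rightarrow> nat \<Rightarrow> ('a list set \<Rightarrow> 'a) set" where
  "pure_strategies G i = (\<Pi>\<^sub>E I\<in>eg_info G i. info_actions G I)"

definition info_set_of :: "'a extensive_game \<Rightarrow> 'a list \<Rightarrow> 'a list set" where
  "info_set_of G h = (THE I. I \<in> eg_info G (eg_player_fun G h) \<and> h \<in> I)"

definition outcome :: "'a extensive_game \<Rightarrow> (nat \<Rightarrow> 'a list set \<Rightarrow> 'a) \<Rightarrow> 'a list" where
  "outcome G s = (THE z. z \<in> terminal_histories G \<and>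
     (\<forall>k<length z. z ! k = s (eg_player_fun G (take k z)) (info_set_of G (take k z))))"


section \<open>Strategic games\<close>

record ('p, 's) strategic_game =
  sg_players :: "'p set"
  sg_strategies :: "'p \<Rightarrow> 's set"
  sg_utility :: "'p \<Rightarrow> ('p \<Rightarrow> 's) \<Rightarrow> real"

definition profiles :: "('p, 's) strategic_game \<Rightarrow> ('p \<Rightarrow> 's) set" where
  "profiles A = (\<Pi>\<^sub>E i\<in>sg_players A. sg_strategies A i)"

definition strategic_isomorphic ::
    "('p, 's) strategic_game \<Rightarrow> ('p, 't) strategic_game \<Rightarrow> bool" where
  "strategic_isomorphic A B \<longleftrightarrow>
     sg_players A = sg_players B \<and>
     (\<exists>g. (\<forall>i\<in>sg_players A. bij_betw (g i) (sg_strategies A i) (sg_strategies B i)) \<and>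
          (\<forall>i\<in>sg_players A. \<forall>s\<in>profiles A.
             sg_utility A i s = sg_utility B i (\<lambda>k\<in>sg_players A. g k (s k))))"

definition normal_representation ::
    "'a extensive_game \<Rightarrow> (nat, 'a list set \<Rightarrow> 'a) strategic_game" where
  "normal_representation G =
     \<lparr>sg_players = eg_players G,
      sg_strategies = pure_strategies G,
      sg_utility = (\<lambda>i s. eg_utility G i (outcome G s))\<rparr>"


section \<open>Systems of \<open>m\<close> qubits\<close>

text \<open>Since \<open>m\<close> is quantified inside the theorem, the Hilbert space of \<open>m\<close> qubits cannot be indexed
  by a type. It is represented by coordinates in the product basis: a product basis vector is an
  element \<open>x\<close> of \<open>bits m\<close>, where \<open>x j\<close> is the basis vector of the \<open>j\<close>-th factor (an element of the
  two-element type \<open>2\<close>, which also indexes the entries of \<open>complex^2^2\<close>), and a vector is a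
  complex-valued function on \<open>bits m\<close>, extended by 0.\<close>

type_synonym qvec = "(nat \<Rightarrow> 2) \<Rightarrow> complex"

definition bits :: "nat \<Rightarrow> (nat \<Rightarrow> 2) set" where
  "bits m = ({1..m} \<rightarrow>\<^sub>E UNIV)"

definition qubit_space :: "nat \<Rightarrow> qvec set" where
  "qubit_space m = {\<psi>. \<forall>x. x \<notin> bits m \<longrightarrow> \<psi> x = 0}"

definition braket :: "nat \<Rightarrow> qvec \<Rightarrow> qvec \<Rightarrow> complex" where
  "braket m \<phi> \<psi> = (\<Sum>x\<in>bits m. cnj (\<phi> x) * \<psi> x)"

definition orthonormal_basis :: "nat \<Rightarrow> qvec set \<Rightarrow> bool" where
  "orthonormal_basis m B \<longleftrightarrow>
     finite B \<and> B \<subseteq> qubit_space m \<and>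
     (\<forall>b\<in>B. \<forall>b'\<in>B. braket m b b' = (if b = b' then 1 else 0)) \<and>
     (\<forall>\<psi>\<in>qubit_space m. \<exists>c. \<psi> = (\<lambda>x. \<Sum>b\<in>B. c b * b x))"

definition adjoint_matrix :: "complex^'n^'n \<Rightarrow> complex^'n^'n" where
  "adjoint_matrix U = map_matrix cnj (transpose U)"

definition SU2 :: "(complex^2^2) set" where
  "SU2 = {U. U ** adjoint_matrix U = mat 1 \<and> adjoint_matrix U ** U = mat 1 \<and> det U = 1}"

text \<open>The operator \<open>U 1 \<otimes> \<dots> \<otimes> U m\<close>, whose matrix entry at \<open>(x, y)\<close> is the product of the
  entries \<open>U j $ x j $ y j\<close>. The lemma \<open>tensor_op_product_vec\<close> shows that it acts on product
  vectors factorwise.\<close>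

definition tensor_op :: "nat \<Rightarrow> (nat \<Rightarrow> complex^2^2) \<Rightarrow> qvec \<Rightarrow> qvec" where
  "tensor_op m U \<psi> = (\<lambda>x. if x \<in> bits m
      then \<Sum>y\<in>bits m. (\<Prod>j\<in>{1..m}. U j $ x j $ y j) * \<psi> y else 0)"

definition product_vec :: "nat \<Rightarrow> (nat \<Rightarrow> complex^2) \<Rightarrow> qvec" where
  "product_vec m \<phi> = (\<lambda>x. if x \<in> bits m then \<Prod>j\<in>{1..m}. \<phi> j $ x j else 0)"

lemma tensor_op_product_vec:
  "tensor_op m U (product_vec m \<phi>) = product_vec m (\<lambda>j. U j *v \<phi> j)"
proof
  fix x :: "nat \<Rightarrow> 2"
  have "(\<Sum>y\<in>bits m. (\<Prod>j\<in>{1..m}. U j $ x j $ y j) * product_vec m \<phi> y)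
      = (\<Sum>y\<in>bits m. \<Prod>j\<in>{1..m}. U j $ x j $ y j * \<phi> j $ y j)"
    by (intro sum.cong) (auto simp: product_vec_def prod.distrib)
  also have "\<dots> = (\<Prod>j\<in>{1..m}. \<Sum>c\<in>UNIV. U j $ x j $ c * \<phi> j $ c)"
    unfolding bits_def by (rule prod_sum_PiE [symmetric]) auto
  finally show "tensor_op m U (product_vec m \<phi>) x = product_vec m (\<lambda>j. U j *v \<phi> j) x"
    by (simp add: tensor_op_def product_vec_def matrix_vector_mult_def)
qed


section \<open>Quantum games\<close>

text \<open>The Hilbert space is given by the number of qubits together with the chosen basis;
  \<open>qg_owner\<close> is the map \<open>\<xi>\<close>.\<close>

record 'p quantum_game =
  qg_qubits :: nat
  qg_basis :: "qvec set"
  qg_players :: "'p set"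
  qg_init :: qvec
  qg_owner :: "nat \<Rightarrow> 'p"
  qg_ops :: "nat \<Rightarrow> (complex^2^2) set"
  qg_payoff :: "'p \<Rightarrow> qvec \<Rightarrow> real"

definition is_quantum_game :: "'p quantum_game \<Rightarrow> bool" where
  "is_quantum_game Q \<longleftrightarrow>
     qg_qubits Q \<ge> 1 \<and>
     orthonormal_basis (qg_qubits Q) (qg_basis Q) \<and>
     finite (qg_players Q) \<and> card (qg_players Q) \<le> qg_qubits Q \<and>
     qg_init Q \<in> qubit_space (qg_qubits Q) \<and>
     braket (qg_qubits Q) (qg_init Q) (qg_init Q) = 1 \<and>
     qg_owner Q ` {1..qg_qubits Q} = qg_players Q \<and>
     (\<forall>j\<in>{1..qg_qubits Q}. qg_ops Q j \<subseteq> SU2) \<and>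
     (\<forall>i\<in>qg_players Q. \<exists>v :: qvec \<Rightarrow> real. \<forall>\<psi>\<in>qubit_space (qg_qubits Q).
        qg_payoff Q i \<psi> = (\<Sum>b\<in>qg_basis Q. v b * (cmod (braket (qg_qubits Q) b \<psi>))\<^sup>2))"

definition quantum_strategies :: "'p quantum_game \<Rightarrow> 'p \<Rightarrow> (nat \<Rightarrow> complex^2^2) set" where
  "quantum_strategies Q i = (\<Pi>\<^sub>E j\<in>{j \<in> {1..qg_qubits Q}. qg_owner Q j = i}. qg_ops Q j)"

definition final_state :: "'p quantum_game \<Rightarrow> ('p \<Rightarrow> nat \<Rightarrow> complex^2^2) \<Rightarrow> qvec" where
  "final_state Q \<tau> = tensor_op (qg_qubits Q) (\<lambda>j. \<tau> (qg_owner Q j) j) (qg_init Q)"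

definition quantum_strategic_game ::
    "'p quantum_game \<Rightarrow> ('p, nat \<Rightarrow> complex^2^2) strategic_game" where
  "quantum_strategic_game Q =
     \<lparr>sg_players = qg_players Q,
      sg_strategies = quantum_strategies Q,
      sg_utility = (\<lambda>i \<tau>. qg_payoff Q i (final_state Q \<tau>))\<rparr>"

end

theory Submission
  imports Defs
begin

text \<open>The tree structure of the game plays no role: a pure strategy profile is a choice of one of two
  actions at each of finitely many information sets, so it is a bit string, and the utilities are
  arbitrary functions of that string. Assign one qubit to each information set, start in a product
  basis vector, and let the player keep or flip each qubit; the final state is then the basis vector
  labelled by the profile, and the payoff functional can read off any utility. Every player also
  gets a dummy qubit with only the identity available, so that the ownership map is surjective even
  if some player never moves.\<close>

definition ket :: "(nat \<Rightarrow> 2) \<Rightarrow> qvec" where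
  "ket x = (\<lambda>y. if y = x then 1 else 0)"

lemma inj_ket: "inj ket"
  by (rule injI) (metis ket_def zero_neq_one)

lemma finite_bits: "finite (bits m)"
  unfolding bits_def by (intro finite_PiE) auto

lemma ket_in_qubit_space: "x \<in> bits m \<Longrightarrow> ket x \<in> qubit_space m"
  by (auto simp: qubit_space_def ket_def)

lemma braket_ket:
  assumes "x \<in> bits m"
  shows "braket m (ket x) \<psi> = \<psi> x"
proof -
  have "braket m (ket x) \<psi> = (\<Sum>y\<in>bits m. if y = x then \<psi> y else 0)"
    unfolding braket_def by (intro sum.cong) (auto simp: ket_def)
  then show ?thesis
    using assms by (simp add: finite_bits)
qed

lemma orthonormal_basis_ket: "orthonormal_basis m (ket ` bits m)"
proof -
  \<comment> \<open>The coefficient of a basis vector is the coordinate of \<psi> at its label,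
    which \<open>inv ket\<close> recovers. Outside \<open>bits m\<close> both sides vanish, as
    \<psi> lies in \<open>qubit_space m\<close>.\<close>
  have "\<psi> = (\<lambda>x. \<Sum>b\<in>ket ` bits m. \<psi> (inv ket b) * b x)" if "\<psi> \<in> qubit_space m" for \<psi>
  proof
    fix x
    have "(\<Sum>b\<in>ket ` bits m. \<psi> (inv ket b) * b x) = (\<Sum>y\<in>bits m. if x = y then \<psi> y else 0)"
      by (simp add: sum.reindex inj_on_subset[OF inj_ket] inj_ket)
         (auto simp: ket_def intro!: sum.cong)
    also have "\<dots> = \<psi> x"
      using that by (auto simp: finite_bits qubit_space_def)
    finally show "\<psi> x = (\<Sum>b\<in>ket ` bits m. \<psi> (inv ket b) * b x)" ..
  qed
  then have "\<forall>\<psi>\<in>qubit_space m. \<exists>c. \<psi> = (\<lambda>x. \<Sum>b\<in>ket ` bits m. c b * b x)"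
    by (intro ballI exI)
  moreover have "braket m b b' = (if b = b' then 1 else 0)"
    if b: "b \<in> ket ` bits m" and b': "b' \<in> ket ` bits m" for b b'
  proof -
    obtain x y where "x \<in> bits m" "b = ket x" "b' = ket y"
      using b b' by blast
    then show ?thesis
      using inj_eq[OF inj_ket, of x y] by (simp add: braket_ket ket_def[of y])
  qed
  ultimately show ?thesis
    unfolding orthonormal_basis_def by (simp add: finite_bits ket_in_qubit_space image_subset_iff)
qed

text \<open>Basis vectors are product vectors, which gives access to the factorwise action of
  \<open>tensor_op\<close>. Two distinct labels in \<open>bits m\<close> already differ at some
  position in \<open>{1..m}\<close>, where the product has a zero factor.\<close>

lemma product_vec_axis:
  assumes "x \<in> bits m"
  shows "product_vec m (\<lambda>j. axis (x j) 1) = ket x"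
proof
  fix y
  show "product_vec m (\<lambda>j. axis (x j) 1) y = ket x y"
  proof (cases "y = x")
    case True
    with assms show ?thesis
      by (simp add: product_vec_def ket_def axis_def)
  next
    case False
    have "\<exists>j\<in>{1..m}. y j \<noteq> x j" if "y \<in> bits m"
      using assms that False PiE_ext unfolding bits_def by metis
    then have "y \<in> bits m \<Longrightarrow> (\<Prod>j\<in>{1..m}. axis (x j) 1 $ y j :: complex) = 0"
      by (intro prod_zero) (simp_all add: axis_def)
    with False show ?thesis
      by (simp add: product_vec_def ket_def)
  qed
qed

text \<open>A qubit starts in the basis vector with index 1, and \<open>bit_op c\<close> sends it to the basis vector
  with index \<open>c\<close>. The flip is a rotation rather than the Pauli matrix, whose determinant is \<open>-1\<close>.\<close>

definition bit_op :: "2 \<Rightarrow> complex^2^2" where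
  "bit_op c = (if c = 1 then mat 1 else vector [vector [0, -1], vector [1, 0]])"

lemma bit_op_mult_axis: "bit_op c *v axis 1 1 = axis c 1"
  using exhaust_2[of c]
  by (auto simp: bit_op_def vec_eq_iff matrix_vector_mult_def sum_2 forall_2 axis_def mat_def)

lemma inj_bit_op: "inj bit_op"
proof (rule injI)
  fix c d assume "bit_op c = bit_op d"
  then have "axis c 1 = (axis d 1 :: complex^2)"
    by (metis bit_op_mult_axis)
  then show "c = d"
    by (simp add: axis_eq_axis)
qed

lemma bit_op_SU2: "bit_op c \<in> SU2"
  by (simp add: SU2_def bit_op_def adjoint_matrix_def map_matrix_def transpose_def det_2
      vec_eq_iff matrix_matrix_mult_def sum_2 forall_2 mat_def)

text \<open>Operators on single qubits can write any bit string: the operator on qubit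
  \<open>j\<close> turns its initial 1 into \<open>x j\<close>. Labels are restricted to
  \<open>{1..m}\<close> because \<open>bits m\<close> contains only extensional functions.\<close>

lemma tensor_op_bit_op:
  assumes "\<And>j. j \<in> {1..m} \<Longrightarrow> U j = bit_op (x j)"
  shows "tensor_op m U (ket (\<lambda>j\<in>{1..m}. 1)) = ket (restrict x {1..m})"
proof -
  have "tensor_op m U (ket (\<lambda>j\<in>{1..m}. 1))
      = tensor_op m U (product_vec m (\<lambda>j. axis ((\<lambda>j\<in>{1..m}. 1) j) 1))"
    by (subst product_vec_axis) (auto simp: bits_def)
  also have "\<dots> = product_vec m (\<lambda>j. U j *v axis ((\<lambda>j\<in>{1..m}. 1) j) 1)"
    by (rule tensor_op_product_vec)
  also have "\<dots> = product_vec m (\<lambda>j. axis (restrict x {1..m} j) 1)"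
    unfolding product_vec_def
    by (intro ext if_cong prod.cong refl) (simp add: assms bit_op_mult_axis)
  also have "\<dots> = ket (restrict x {1..m})"
    by (rule product_vec_axis) (auto simp: bits_def)
  finally show ?thesis .
qed

text \<open>This isolates the quantum construction from game trees: \<open>D i\<close> holds the
  decision points of player \<open>i\<close>, and a strategy picks one of two elements of
  \<open>A i d\<close> at each of them.\<close>

theorem quantum_realization:
  fixes B :: "('p, 'd \<Rightarrow> 'a) strategic_game" and D :: "'p \<Rightarrow> 'd set" and A :: "'p \<Rightarrow> 'd \<Rightarrow> 'a set"
  assumes fin: "finite (sg_players B)" and ne: "sg_players B \<noteq> {}"
    and finD: "\<And>i. i \<in> sg_players B \<Longrightarrow> finite (D i)"
    and strat: "\<And>i. i \<in> sg_players B \<Longrightarrow> sg_strategies B i = (\<Pi>\<^sub>E d\<in>D i. A i d)"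
    and two: "\<And>i d. i \<in> sg_players B \<Longrightarrow> d \<in> D i \<Longrightarrow> card (A i d) = 2"
  shows "\<exists>Q :: 'p quantum_game. is_quantum_game Q \<and> qg_players Q = sg_players B \<and>
           strategic_isomorphic (quantum_strategic_game Q) B"
proof -
  define N where "N = sg_players B"
  \<comment> \<open>Index set of the qubits: \<open>(i, Some d)\<close> for the decision of
    \<open>i\<close> at \<open>d\<close>, \<open>(i, None)\<close> for the dummy of
    \<open>i\<close>. Pairing with \<open>i\<close> separates decision points that several players
    share.\<close>
  define J where "J = Sigma N (\<lambda>i. insert None (Some ` D i))"
  define m where "m = card J"
  have finJ: "finite J"
    using fin finD by (auto simp: J_def N_def)
  have dummy: "(\<lambda>i. (i, None)) ` N \<subseteq> J"
    by (auto simp: J_def)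
  have cardN: "card N \<le> m"
    unfolding m_def using dummy finJ
    by (metis card_image card_mono inj_onI prod.inject)
  have m1: "m \<ge> 1"
    using cardN fin ne card_gt_0_iff[of N] by (simp add: N_def)
  obtain \<beta> where \<beta>: "bij_betw \<beta> {1..m} J"
    using ex_bij_betw_nat_finite_1[OF finJ] m_def by blast
  define q where "q i d = inv_into {1..m} \<beta> (i, Some d)" for i d
  have q: "q i d \<in> {1..m}" "\<beta> (q i d) = (i, Some d)" if "i \<in> N" "d \<in> D i" for i d
  proof -
    have "(i, Some d) \<in> \<beta> ` {1..m}"
      using that \<beta> by (auto simp: bij_betw_def J_def)
    then show "q i d \<in> {1..m}" "\<beta> (q i d) = (i, Some d)"
      unfolding q_def by (fact inv_into_into, fact f_inv_into_f)
  qed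
  have \<beta>J: "\<beta> j \<in> J" if "j \<in> {1..m}" for j
    using that \<beta> by (auto simp: bij_betw_def)
  have q_eq: "j = q i d" if "j \<in> {1..m}" "\<beta> j = (i, Some d)" for j i d
    using that \<beta> by (metis q_def bij_betw_def inv_into_f_f)
  define owner where "owner j = fst (\<beta> j)" for j
  have owner: "owner ` {1..m} = N"
  proof -
    have "owner ` {1..m} = fst ` J"
      using \<beta> by (auto simp: owner_def bij_betw_def image_image[symmetric])
    then show ?thesis
      by (force simp: J_def)
  qed
  \<comment> \<open>A dummy admits one operator, \<open>bit_op 1\<close>, which is the identity, so
    it adds no strategies.\<close>
  define ops where "ops j = (if snd (\<beta> j) = None then {bit_op 1} else range bit_op)" for j
  have ops_range: "ops j \<subseteq> range bit_op" for j
    by (auto simp: ops_def)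
  have "\<exists>f :: 2 \<Rightarrow> 'a. bij_betw f UNIV (A i d)" if "i \<in> N" "d \<in> D i" for i d
    using two that by (intro finite_same_card_bij) (auto simp: N_def intro: card_ge_0_finite)
  then obtain act :: "'p \<Rightarrow> 'd \<Rightarrow> 2 \<Rightarrow> 'a"
    where act: "\<And>i d. i \<in> N \<Longrightarrow> d \<in> D i \<Longrightarrow> bij_betw (act i d) UNIV (A i d)"
    by metis
  define decode where "decode x = (\<lambda>k\<in>N. \<lambda>d\<in>D k. act k d (x (q k d)))" for x
  \<comment> \<open>The payoff weight of a basis vector is the utility of the profile that its label
    encodes.\<close>
  define v where "v i b = sg_utility B i (decode (inv ket b))" for i b
  define Q where "Q = \<lparr>qg_qubits = m, qg_basis = ket ` bits m, qg_players = N,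
      qg_init = ket (\<lambda>j\<in>{1..m}. 1), qg_owner = owner, qg_ops = ops,
      qg_payoff = (\<lambda>i \<psi>. \<Sum>b\<in>ket ` bits m. v i b * (cmod (braket m b \<psi>))\<^sup>2)\<rparr>"
  have payoff: "qg_payoff Q i (ket x) = sg_utility B i (decode x)" if "x \<in> bits m" for i x
  proof -
    have "qg_payoff Q i (ket x) = (\<Sum>y\<in>bits m. v i (ket y) * (cmod (braket m (ket y) (ket x)))\<^sup>2)"
      by (simp add: Q_def sum.reindex inj_on_subset[OF inj_ket])
    \<comment> \<open>Measuring a basis vector gives its own label with probability 1, so one weight
      survives.\<close>
    also have "\<dots> = (\<Sum>y\<in>bits m. if y = x then v i (ket y) else 0)"
      by (intro sum.cong refl) (simp add: braket_ket, simp add: ket_def)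
    also have "\<dots> = sg_utility B i (decode x)"
      using that by (simp add: finite_bits v_def inj_ket)
    finally show ?thesis .
  qed
  have quantum: "is_quantum_game Q"
  proof -
    have "(\<lambda>j\<in>{1..m}. 1) \<in> bits m"
      by (auto simp: bits_def)
    moreover have "ops j \<subseteq> SU2" for j
      using ops_range bit_op_SU2 by blast
    ultimately show ?thesis
      using m1 cardN fin owner orthonormal_basis_ket[of m]
      by (auto simp: is_quantum_game_def Q_def N_def ket_in_qubit_space braket_ket)
         (auto simp: ket_def)
  qed
  define bit where "bit = inv bit_op"
  have bit_bit_op [simp]: "bit (bit_op c) = c" for c
    by (simp add: bit_def inj_bit_op)
  have bit_op_bit: "bit_op (bit U) = U" if "U \<in> ops j" for U j
    using that ops_range[of j] by auto
  \<comment> \<open>The isomorphism reads the actions off the operators on the decision qubits of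
    player \<open>k\<close>.\<close>
  define g where "g k \<tau> = (\<lambda>d\<in>D k. act k d (bit (\<tau> (q k d))))" for k and \<tau> :: "nat \<Rightarrow> complex^2^2"
  have qs: "quantum_strategies Q k = (\<Pi>\<^sub>E j\<in>{j \<in> {1..m}. owner j = k}. ops j)" for k
    by (simp add: quantum_strategies_def Q_def)
  have bij: "bij_betw (g k) (quantum_strategies Q k) (sg_strategies B k)" if k: "k \<in> N" for k
  proof (rule bij_betw_imageI)
    show "inj_on (g k) (quantum_strategies Q k)"
    proof (rule inj_onI)
      fix \<tau> \<tau>'
      assume \<tau>: "\<tau> \<in> quantum_strategies Q k" and \<tau>': "\<tau>' \<in> quantum_strategies Q k"
        and eq: "g k \<tau> = g k \<tau>'"
      show "\<tau> = \<tau>'"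
      proof (rule PiE_ext[OF \<tau>[unfolded qs] \<tau>'[unfolded qs]])
        fix j assume j: "j \<in> {j \<in> {1..m}. owner j = k}"
        have in_ops: "\<tau> j \<in> ops j" "\<tau>' j \<in> ops j"
          using \<tau> \<tau>' j by (auto simp: qs)
        show "\<tau> j = \<tau>' j"
        \<comment> \<open>On a dummy the strategies agree because its operator set is a singleton.
          Elsewhere the action determines the bit, and the bit determines the operator.\<close>
        proof (cases "snd (\<beta> j)")
          case None
          with in_ops show ?thesis
            by (simp add: ops_def)
        next
          case (Some d)
          then have \<beta>j: "\<beta> j = (k, Some d)"
            using j by (auto simp: owner_def prod_eq_iff)
          then have d: "d \<in> D k" and jq: "j = q k d"
            using \<beta>J[of j] j q_eq by (auto simp: J_def)
          have "act k d (bit (\<tau> j)) = act k d (bit (\<tau>' j))"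
            using fun_cong[OF eq, of d] d jq by (simp add: g_def)
          then have "bit (\<tau> j) = bit (\<tau>' j)"
            using act[OF k d] by (auto simp: bij_betw_def inj_eq)
          then show ?thesis
            using in_ops bit_op_bit by metis
        qed
      qed
    qed
    show "g k ` quantum_strategies Q k = sg_strategies B k"
    proof (intro equalityI subsetI)
      fix s assume "s \<in> g k ` quantum_strategies Q k"
      then show "s \<in> sg_strategies B k"
        using k strat bij_betwE[OF act[OF k]] by (auto simp: g_def N_def)
    next
      fix s assume "s \<in> sg_strategies B k"
      then have s: "s \<in> (\<Pi>\<^sub>E d\<in>D k. A k d)"
        using strat k by (simp add: N_def)
      define \<tau> where "\<tau> = (\<lambda>j\<in>{j \<in> {1..m}. owner j = k}.
        case snd (\<beta> j) of None \<Rightarrow> bit_op 1 | Some d \<Rightarrow> bit_op (inv (act k d) (s d)))"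
      have "\<tau> \<in> quantum_strategies Q k"
        unfolding qs \<tau>_def by (auto simp: ops_def split: option.split)
      moreover have "g k \<tau> = s"
      proof
        fix d
        show "g k \<tau> d = s d"
        proof (cases "d \<in> D k")
          case True
          then have "s d \<in> range (act k d)"
            using s act[OF k True] by (auto simp: bij_betw_def)
          then show ?thesis
            using True q[OF k True] by (simp add: g_def \<tau>_def owner_def f_inv_into_f)
        next
          case False
          then show ?thesis
            using s by (auto simp: g_def)
        qed
      qed
      ultimately show "s \<in> g k ` quantum_strategies Q k"
        by blast
    qed
  qed
  have utility: "qg_payoff Q i (final_state Q \<tau>) = sg_utility B i (\<lambda>k\<in>N. g k (\<tau> k))"
    if \<tau>: "\<tau> \<in> (\<Pi>\<^sub>E k\<in>N. quantum_strategies Q k)" for i \<tau>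
  proof -
    define x where "x j = bit (\<tau> (owner j) j)" for j
    have "\<tau> (owner j) j \<in> ops j" if "j \<in> {1..m}" for j
    proof -
      have "\<tau> (owner j) \<in> quantum_strategies Q (owner j)"
        using \<tau> owner that by auto
      then show ?thesis
        using that by (auto simp: qs)
    qed
    then have "final_state Q \<tau> = ket (restrict x {1..m})"
      unfolding final_state_def Q_def
      by (simp only: quantum_game.simps, intro tensor_op_bit_op) (metis x_def bit_op_bit)
    moreover have "restrict x {1..m} \<in> bits m"
      by (auto simp: bits_def)
    \<comment> \<open>Qubit \<open>q k d\<close> belongs to \<open>k\<close>, so its bit in
      \<open>x\<close> comes from the strategy of \<open>k\<close>.\<close>
    moreover have "decode (restrict x {1..m}) = (\<lambda>k\<in>N. g k (\<tau> k))"
      unfolding decode_def g_def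
      by (intro restrict_ext) (use q in \<open>simp add: x_def owner_def\<close>)
    ultimately show ?thesis
      by (simp add: payoff)
  qed
  have "strategic_isomorphic (quantum_strategic_game Q) B"
    unfolding strategic_isomorphic_def
    using bij utility by (intro conjI exI[of _ g])
      (auto simp: quantum_strategic_game_def profiles_def Q_def N_def)
  with quantum show ?thesis
    by (intro exI[of _ Q]) (simp add: Q_def N_def)
qed

theorem proposition4p1:
  fixes G :: "'a extensive_game"
  assumes "is_extensive_game G"
    and "\<forall>i\<in>eg_players G. \<forall>I\<in>eg_info G i. card (info_actions G I) = 2"
  shows "\<exists>Q :: nat quantum_game.
           is_quantum_game Q \<and>
           qg_players Q = eg_players G \<and>
           strategic_isomorphic (quantum_strategic_game Q) (normal_representation G)"
proof -
  have "finite (eg_info G i)" if "i \<in> eg_players G" for i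
  \<comment> \<open>A family of sets with finite union is finite; here the union consists of
    histories.\<close>
  proof (rule finite_UnionD)
    have "\<Union> (eg_info G i) \<subseteq> eg_histories G"
      using assms(1) that by (auto simp: is_extensive_game_def partition_on_def decision_histories_def)
    then show "finite (\<Union> (eg_info G i))"
      using assms(1) finite_subset by (auto simp: is_extensive_game_def)
  qed
  moreover have "finite (eg_players G)" "eg_players G \<noteq> {}"
    using assms(1) by (auto simp: is_extensive_game_def)
  ultimately show ?thesis
    using assms(2) quantum_realization[of "normal_representation G" "eg_info G" "\<lambda>_. info_actions G"]
    by (simp add: normal_representation_def pure_strategies_def)
qed

end
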